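(* Let $T$ and $T^{*}$ be finite trees with $\min\{n(T), n(T^{*})\} \geq 3$. Then $$\operatorname{gp}(T \,\square\, T^{*}) = \operatorname{gp}(T) + \operatorname{gp}(T^{*}).$$
   Context: For a graph $G$, $n(G)$ denotes the number of vertices of $G$. For a connected graph $G$, $d_G(x,y)$ denotes the number of edges on a shortest $x,y$-path in $G$. A set $S \subseteq V(G)$ is a general position set of $G$ if $d_G(x,y) \neq d_G(x,z) + d_G(z,y)$ for all pairwise distinct $x,y,z \in S$ (that is, no three pairwise distinct vertices of $S$ lie on a common shortest path). The general position number $\operatorname{gp}(G)$ is the cardinality of a largest general position set of $G$. The Cartesian product $G \,\square\, H$ of graphs $G$ and $H$ is the graph with vertex set $V(G)\times V(H)$ in which $(g,h)$ and $(g',h')$ are adjacent if and only if either $g=g'$ and $hh'\in E(H)$, or $h=h'$ and $gg'\in E(G)$. *)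

theory Defs
  imports "Graph_Theory.Graph_Theory"
begin

text \<open>
  A finite simple graph is a \<^locale>\<open>pair_graph\<close>: a finite vertex set together with a symmetric,
  irreflexive set of arcs, each undirected edge being represented by its two orientations.
\<close>

text \<open>
  The number of edges on a shortest path. The set is nonempty whenever \<open>u\<close> and \<open>v\<close> lie in the same
  component; only connected graphs are of interest.
\<close>

definition graph_dist :: "'a pair_pre_digraph \<Rightarrow> 'a \<Rightarrow> 'a \<Rightarrow> nat" where
  "graph_dist G u v = Inf {length p | p. pre_digraph.apath (with_proj G) u p v}"

definition gen_pos_set :: "'a pair_pre_digraph \<Rightarrow> 'a set \<Rightarrow> bool" where
  "gen_pos_set G S \<longleftrightarrow> S \<subseteq> pverts G \<and>
     (\<forall>x\<in>S. \<forall>y\<in>S. \<forall>z\<in>S. x \<noteq> y \<and> x \<noteq> z \<and> y \<noteq> z \<longrightarrow>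
        graph_dist G x y \<noteq> graph_dist G x z + graph_dist G z y)"

definition gp :: "'a pair_pre_digraph \<Rightarrow> nat" where
  "gp G = Max {card S | S. gen_pos_set G S}"

text \<open>
  The constant \<^const>\<open>tree\<close> of the library forbids directed cycles, and the closed walk that
  traverses one edge back and forth is such a cycle, so no symmetric digraph with an edge is a
  \<^const>\<open>tree\<close>. In a simple graph the undirected cycles are the directed ones of length at
  least 3.
\<close>

definition undirected_tree :: "'a pair_pre_digraph \<Rightarrow> bool" where
  "undirected_tree G \<longleftrightarrow> pair_graph G \<and> Digraph_Component.connected (with_proj G) \<and>
     \<not> (\<exists>p. pre_digraph.cycle (with_proj G) p \<and> 3 \<le> length p)"

definition cart_prod ::
    "'a pair_pre_digraph \<Rightarrow> 'b pair_pre_digraph \<Rightarrow> ('a \<times> 'b) pair_pre_digraph"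
    (infixr \<open>\<box>\<close> 80) where
  "G \<box> H = \<lparr> pverts = pverts G \<times> pverts H,
     parcs = {((g, h), (g', h')) | g h g' h'.
        g = g' \<and> g \<in> pverts G \<and> (h, h') \<in> parcs H \<or>
        h = h' \<and> h \<in> pverts H \<and> (g, g') \<in> parcs G} \<rparr>"

lemma pair_graph_cart_prod:
  assumes "pair_graph G" "pair_graph H"
  shows "pair_graph (G \<box> H)"
proof -
  interpret G: pair_graph G by fact
  interpret H: pair_graph H by fact
  have sub: "parcs (G \<box> H) \<subseteq> (pverts G \<times> pverts H) \<times> (pverts G \<times> pverts H)"
    by (auto simp: cart_prod_def dest: G.wellformed' H.wellformed')
  show ?thesis
  proof
    show "finite (pverts (G \<box> H))"
      by (simp add: cart_prod_def G.pair_finite_verts H.pair_finite_verts)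
    show "finite (parcs (G \<box> H))"
      by (rule finite_subset[OF sub]) (simp add: G.pair_finite_verts H.pair_finite_verts)
    show "symmetric (with_proj (G \<box> H))"
      by (auto simp: symmetric_def cart_prod_def intro!: symI
          dest: G.arcs_symmetric H.arcs_symmetric)
    show "fst e \<noteq> snd e" if "e \<in> parcs (G \<box> H)" for e
      using that by (auto simp: cart_prod_def dest: G.no_loops' H.no_loops')
  qed (auto simp: cart_prod_def dest: G.wellformed' H.wellformed')
qed

end

theory Submission
  imports Defs
begin

text \<open>
  Distances in the product add up, so \<open>z\<close> lies between \<open>x\<close> and \<open>y\<close> iff it does so in both
  coordinates. For a vertex \<open>z\<close> of a tree, not being separated by \<open>z\<close> is a transitive relation on
  the remaining vertices. If \<open>S\<close> is in general position and \<open>z \<in> S\<close>, any two other points of \<open>S\<close>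
  are thus related in one of two such relations, and a complete graph covered by two transitive
  relations is already covered by one of them. Hence each \<open>z \<in> S\<close> has a coordinate in which it
  lies between no two other points, which splits \<open>S\<close> into two parts that project injectively to
  general position sets of the factors.

  For the lower bound, take a largest general position set \<open>A\<close> of \<open>T\<close> and a vertex \<open>c\<close> outside it,
  such that no path from a point of \<open>A\<close> to \<open>c\<close> meets another point of \<open>A\<close>. The median of any three
  points of \<open>A\<close> is such a \<open>c\<close>; if \<open>A\<close> has only two points, any three vertices yield a suitable
  pair and \<open>c\<close>. With \<open>A'\<close> and \<open>c'\<close> for \<open>T'\<close> the cross
  \<open>A \<times> {c'} \<union> {c} \<times> A'\<close> is in general position.
\<close>

section \<open>Walks, paths and distances\<close>

text \<open>Betweenness with the middle vertex as the middle argument. It is not strict: vertices of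
  a connected graph lie between themselves and any other vertex.\<close>

abbreviation on_geodesic :: "'a pair_pre_digraph \<Rightarrow> 'a \<Rightarrow> 'a \<Rightarrow> 'a \<Rightarrow> bool" where
  "on_geodesic G x z y \<equiv> graph_dist G x y = graph_dist G x z + graph_dist G z y"

text \<open>The shortened walk uses pairwise distinct arcs of \<open>p\<close>, hence the length
  bound. The vertex inclusion is what later lets a path avoid a given vertex or locates a vertex on
  one of two joined paths.\<close>

lemma (in wf_digraph) awalk_imp_apath_within:
  assumes "awalk u p v"
  obtains q where "apath u q v" "set (awalk_verts u q) \<subseteq> set (awalk_verts u p)"
    "length q \<le> length p"
proof -
  let ?q = "awalk_to_apath p"
  have q: "apath u ?q v" and sub: "set ?q \<subseteq> set p"
    using assms by (auto intro: apath_awalk_to_apath dest: awalk_to_apath_subset)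
  have "distinct ?q"
    using q distinct_verts_imp_distinct unfolding apath_def by blast
  then have "length ?q = card (set ?q)"
    by (simp add: distinct_card)
  also have "\<dots> \<le> card (set p)"
    using sub by (simp add: card_mono)
  also have "\<dots> \<le> length p"
    by (rule card_length)
  finally have "length ?q \<le> length p" .
  moreover have "set (awalk_verts u ?q) \<subseteq> set (awalk_verts u p)"
  proof -
    have "awalk u ?q v"
      using q by (rule awalkI_apath)
    then show ?thesis
      unfolding set_awalk_verts[OF assms] set_map
      by (subst set_awalk_verts) (use sub in \<open>auto simp: image_iff\<close>)
  qed
  ultimately show ?thesis
    using q that by blast
qed

lemma (in pair_wf_digraph) graph_dist_le_length:
  assumes "awalk u p v"
  shows "graph_dist G u v \<le> length p"
proof -
  obtain q where "apath u q v" "length q \<le> length p"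
    using awalk_imp_apath_within[OF assms] by blast
  then have "graph_dist G u v \<le> length q"
    unfolding graph_dist_def by (intro cInf_lower) auto
  with \<open>length q \<le> length p\<close> show ?thesis by simp
qed

lemma (in pair_wf_digraph) awalk_imp_shortest_apath:
  assumes "awalk u p v"
  obtains q where "apath u q v" "length q = graph_dist G u v"
proof -
  \<comment> \<open>\<open>Inf\<close> on \<open>nat\<close> is attained only for a nonempty set;
    shortening the given walk provides an element.\<close>
  have "{length q |q. apath u q v} \<noteq> {}"
    using apath_awalk_to_apath[OF assms] by blast
  then have "graph_dist G u v \<in> {length q |q. apath u q v}"
    unfolding graph_dist_def by (rule Inf_nat_def1)
  then show ?thesis
    using that by auto
qed

locale connected_pair_graph = pair_graph G for G :: "'a pair_pre_digraph" +
  assumes connected: "Digraph_Component.connected (with_proj G)"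
begin

lemma verts_nonempty: "pverts G \<noteq> {}"
  using connected by (auto simp: connected_conv)

lemma shortest_apath:
  assumes "u \<in> pverts G" "v \<in> pverts G"
  obtains p where "apath u p v" "length p = graph_dist G u v"
proof -
  have "strongly_connected (with_proj G)"
    using pair_sym_arcs connected by (rule symmetric_connected_imp_strongly_connected)
  then have "u \<rightarrow>\<^sup>*\<^bsub>with_proj G\<^esub> v"
    using assms by (auto simp: strongly_connected_def)
  then show ?thesis
    using that awalk_imp_shortest_apath unfolding reachable_awalk by blast
qed

lemma graph_dist_self: "u \<in> pverts G \<Longrightarrow> graph_dist G u u = 0"
  using graph_dist_le_length[of u "[]" u] by (simp add: awalk_Nil_iff)

lemma graph_dist_eq_0D:
  assumes "u \<in> pverts G" "v \<in> pverts G" "graph_dist G u v = 0"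
  shows "u = v"
proof -
  obtain p where "apath u p v" "length p = 0"
    using shortest_apath assms by metis
  then show ?thesis
    by (simp add: apath_Nil_iff)
qed

lemma graph_dist_commute:
  assumes "u \<in> pverts G" "v \<in> pverts G"
  shows "graph_dist G u v = graph_dist G v u"
proof -
  have le: "graph_dist G v u \<le> graph_dist G u v" if uv: "u \<in> pverts G" "v \<in> pverts G" for u v
  proof -
    obtain p where p: "apath u p v" "length p = graph_dist G u v"
      using shortest_apath uv by metis
    then have "awalk v (rev_path p) u"
      by (simp add: apath_def)
    then have "graph_dist G v u \<le> length (rev_path p)"
      by (rule graph_dist_le_length)
    moreover have "length (rev_path p) = length p"
      by (induct p) auto
    ultimately show ?thesis
      using p by simp
  qed
  show ?thesis
    using le assms by (simp add: antisym)
qed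

lemma graph_dist_triangle:
  assumes "u \<in> pverts G" "v \<in> pverts G" "w \<in> pverts G"
  shows "graph_dist G u w \<le> graph_dist G u v + graph_dist G v w"
proof -
  obtain p where p: "apath u p v" "length p = graph_dist G u v"
    using shortest_apath assms by metis
  obtain q where q: "apath v q w" "length q = graph_dist G v w"
    using shortest_apath assms by metis
  have "awalk u (p @ q) w"
    using p q awalk_appendI unfolding apath_def by blast
  then have "graph_dist G u w \<le> length (p @ q)"
    by (rule graph_dist_le_length)
  then show ?thesis
    using p q by simp
qed

lemma graph_dist_arc:
  assumes "(u, v) \<in> parcs G"
  shows "graph_dist G u v = 1"
proof -
  have "awalk u [(u, v)] v"
    using assms by (auto simp: awalk_simps intro: wellformed')
  then have "graph_dist G u v \<le> length [(u, v)]"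
    by (rule graph_dist_le_length)
  moreover have "graph_dist G u v \<noteq> 0"
    using graph_dist_eq_0D[of u v] no_loops'[of u v] wellformed'[of u v] assms by blast
  ultimately show ?thesis
    by simp
qed

end

section \<open>The general position number and projections\<close>

lemma (in pair_graph) finite_gen_pos_set: "gen_pos_set G S \<Longrightarrow> finite S"
  using pair_finite_verts finite_subset unfolding gen_pos_set_def by blast

lemma (in pair_graph) finite_gen_pos_cards: "finite {card S | S. gen_pos_set G S}"
proof (rule finite_subset)
  show "{card S | S. gen_pos_set G S} \<subseteq> card ` Pow (pverts G)"
    by (auto simp: gen_pos_set_def)
qed (simp add: pair_finite_verts)

lemma (in pair_graph) card_le_gp: "gen_pos_set G S \<Longrightarrow> card S \<le> gp G"
  unfolding gp_def using finite_gen_pos_cards by (intro Max_ge) auto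

lemma (in pair_graph) gp_attained:
  obtains S where "gen_pos_set G S" "card S = gp G"
proof -
  \<comment> \<open>The empty set makes the set of cardinalities nonempty, so that
    \<open>Max\<close> belongs to it.\<close>
  have "gen_pos_set G {}"
    by (simp add: gen_pos_set_def)
  then have "gp G \<in> {card S | S. gen_pos_set G S}"
    unfolding gp_def using finite_gen_pos_cards by (intro Max_in) auto
  then show ?thesis
    using that by auto
qed

lemma (in pair_graph) gp_eqI:
  assumes "gen_pos_set G S" "card S = n" "\<And>R. gen_pos_set G R \<Longrightarrow> card R \<le> n"
  shows "gp G = n"
proof -
  obtain R where "gen_pos_set G R" "card R = gp G"
    using gp_attained .
  then show ?thesis
    using assms(3)[of R] card_le_gp[OF assms(1)] assms(2) by simp
qed

text \<open>Testing the points of \<open>A\<close> against all of \<open>S\<close> also forces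
  injectivity: if \<open>f u = f v\<close>, then \<open>f u\<close> lies trivially between
  \<open>f v\<close> and \<open>f w\<close> for a third point \<open>w\<close> of \<open>S\<close>,
  which exists by the bound on \<open>card S\<close>.\<close>

lemma (in connected_pair_graph) card_le_gp_of_projection:
  assumes "f ` S \<subseteq> pverts G" "A \<subseteq> S" "3 \<le> card S"
    and ext: "\<And>x y z. z \<in> A \<Longrightarrow> x \<in> S \<Longrightarrow> y \<in> S \<Longrightarrow> x \<noteq> y \<Longrightarrow> x \<noteq> z \<Longrightarrow> y \<noteq> z \<Longrightarrow>
      \<not> on_geodesic G (f x) (f z) (f y)"
  shows "card A \<le> gp G"
proof -
  have inj: "inj_on f A"
  proof (rule inj_onI, rule ccontr)
    fix u v
    assume uv: "u \<in> A" "v \<in> A" "f u = f v" "u \<noteq> v"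
    have "card {u, v} < card S"
      using assms(3) uv by simp
    then have "\<not> S \<subseteq> {u, v}"
      using card_mono[of "{u, v}" S] by auto
    then obtain w where w: "w \<in> S" "w \<noteq> u" "w \<noteq> v"
      by blast
    have "graph_dist G (f v) (f v) = 0"
      using uv assms by (intro graph_dist_self) auto
    then show False
      using ext[of u v w] w uv assms(2) by auto
  qed
  have "gen_pos_set G (f ` A)"
    unfolding gen_pos_set_def
  proof (intro conjI ballI impI)
    show "f ` A \<subseteq> pverts G"
      using assms by auto
    fix x y z
    assume "x \<in> f ` A" "y \<in> f ` A" "z \<in> f ` A" and ne: "x \<noteq> y \<and> x \<noteq> z \<and> y \<noteq> z"
    then obtain x' y' z' where "x' \<in> A" "y' \<in> A" "z' \<in> A" "x = f x'" "y = f y'" "z = f z'"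
      by blast
    then show "\<not> on_geodesic G x z y"
      using ext[of z' x' y'] ne assms(2) by blast
  qed
  then show ?thesis
    using card_le_gp card_image[OF inj] by metis
qed

section \<open>Unique paths, separation and medians in trees\<close>

locale undirected_tree_graph = connected_pair_graph +
  assumes acyclic: "\<not> (\<exists>p. cycle p \<and> 3 \<le> length p)"
begin

text \<open>A common first arc is removed by induction. If the first arcs differ, the remaining
  paths join to a walk between two different neighbours of \<open>u\<close> that avoids
  \<open>u\<close>; shortened and closed through \<open>u\<close> it becomes a cycle.\<close>

lemma apath_unique:
  assumes "apath u p v" "apath u q v"
  shows "p = q"
  using assms
proof (induction p arbitrary: u q)
  case Nil
  then have "u = v"
    by (simp add: apath_Nil_iff)
  then show ?case
    using Nil apath_nonempty_ends by metis
next
  case (Cons e p')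
  have "u \<noteq> v"
    using apath_nonempty_ends[OF Cons.prems(1)] by simp
  then obtain f q' where q: "q = f # q'"
    using Cons.prems(2) by (cases q) (auto simp: apath_Nil_iff)
  have e: "e \<in> parcs G" "fst e = u" "apath (snd e) p' v" "u \<notin> set (awalk_verts (snd e) p')"
    using Cons.prems(1) by (auto simp: apath_Cons_iff)
  have f: "f \<in> parcs G" "fst f = u" "apath (snd f) q' v" "u \<notin> set (awalk_verts (snd f) q')"
    using Cons.prems(2) by (auto simp: apath_Cons_iff q)
  show ?case
  proof (cases "snd e = snd f")
    case True
    then show ?thesis
      using Cons.IH e f q by (metis prod_eqI)
  next
    case False
    have wp: "awalk (snd e) p' v" and wq: "awalk (snd f) q' v"
      using e f by (auto simp: apath_def)
    have w: "awalk (snd e) (p' @ rev_path q') (snd f)"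
      using wp wq awalk_appendI awalk_rev_path by blast
    have "awalk v (rev_path q') (snd f)"
      using wq by simp
    then have "set (awalk_verts (snd e) (p' @ rev_path q')) =
        set (awalk_verts (snd e) p') \<union> set (awalk_verts (snd f) q')"
      using set_awalk_verts_append[OF wp] awalk_verts_rev_path[OF wq] by simp
    then obtain r where r: "apath (snd e) r (snd f)" "u \<notin> set (awalk_verts (snd e) r)"
      using awalk_imp_apath_within[OF w] e f by blast
    have rn: "r \<noteq> []"
      using r False by (auto simp: apath_Nil_iff)
    have wr: "awalk (snd e) r (snd f)"
      using r by (simp add: apath_def)
    have "(snd f, u) \<in> parcs G"
      using f arcs_symmetric by (metis prod.collapse)
    then have f_u: "awalk (snd f) [(snd f, u)] u"
      by (auto simp: awalk_simps intro: wellformed')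
    have "awalk (snd e) (r @ [(snd f, u)]) u"
      using wr f_u by (rule awalk_appendI)
    then have cyc: "awalk u (e # r @ [(snd f, u)]) u"
      and verts: "awalk_verts (snd e) (r @ [(snd f, u)]) = awalk_verts (snd e) r @ [u]"
      using e by (auto simp: awalk_Cons_iff awalk_verts_append)
    have "distinct (tl (awalk_verts u (e # r @ [(snd f, u)])))"
      using r verts by (simp add: apath_def)
    then have "cycle (e # r @ [(snd f, u)])"
      using cyc unfolding cycle_def by blast
    \<comment> \<open>The ends of \<open>r\<close> differ, so it has an arc; together with the two
      arcs at \<open>u\<close> this is more than one edge traversed back and forth.\<close>
    moreover have "3 \<le> length (e # r @ [(snd f, u)])"
      using rn by (cases r) auto
    ultimately show ?thesis
      using acyclic by blast
  qed
qed

lemma length_apath_eq: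
  assumes "apath u p v"
  shows "length p = graph_dist G u v"
proof -
  have "u \<in> pverts G" "v \<in> pverts G"
    using assms awalk_hd_in_verts awalk_last_in_verts by (auto simp: apath_def)
  then show ?thesis
    using shortest_apath apath_unique assms by metis
qed

text \<open>If distances add up at \<open>c\<close>, shortest paths to and from \<open>c\<close>
  join to a path, which is \<open>p\<close> by uniqueness. Conversely, cutting \<open>p\<close> at
  \<open>c\<close> gives two paths whose lengths are the distances.\<close>

lemma on_geodesic_iff_on_apath:
  assumes p: "apath u p v" and c: "c \<in> pverts G"
  shows "on_geodesic G u c v \<longleftrightarrow> c \<in> set (awalk_verts u p)"
proof
  have uv: "u \<in> pverts G" "v \<in> pverts G"
    using p awalk_hd_in_verts awalk_last_in_verts by (auto simp: apath_def)
  assume eq: "on_geodesic G u c v"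
  obtain q where q: "apath u q c" "length q = graph_dist G u c"
    using shortest_apath uv c by metis
  obtain r where r: "apath c r v" "length r = graph_dist G c v"
    using shortest_apath uv c by metis
  have wq: "awalk u q c" and wr: "awalk c r v"
    using q r by (auto simp: apath_def)
  have w: "awalk u (q @ r) v"
    using wq wr by (rule awalk_appendI)
  \<comment> \<open>A repeated vertex would allow a nonempty closed piece to be cut out, leaving a
    walk shorter than the distance.\<close>
  have "distinct (awalk_verts u (q @ r))"
  proof (rule ccontr)
    assume "\<not> ?thesis"
    then obtain q' r' s' w' where dec: "q @ r = q' @ r' @ s'" "0 < length r'"
      "awalk u q' w'" "awalk w' s' v"
      using awalk_not_distinct_decomp[OF w] by metis
    then have "awalk u (q' @ s') v"
      using awalk_appendI by blast
    then have "graph_dist G u v \<le> length (q' @ s')"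
      by (rule graph_dist_le_length)
    moreover have "length q + length r = length q' + length r' + length s'"
      using dec(1) by (metis length_append add.assoc)
    ultimately show False
      using dec q r eq by simp
  qed
  then have "apath u (q @ r) v"
    using w by (simp add: apath_def)
  then have "p = q @ r"
    using p apath_unique by blast
  then show "c \<in> set (awalk_verts u p)"
    using set_awalk_verts_append[OF wq wr] hd_in_awalk_verts(1)[OF wr] by simp
next
  assume "c \<in> set (awalk_verts u p)"
  then obtain q r where pqr: "p = q @ r" "awalk u q c" "awalk c r v"
    using awalk_decomp p unfolding apath_def by metis
  then have "awlast u q = c"
    by auto
  then have "apath u q c" "apath c r v"
    using p pqr apath_append_iff by auto
  then show "on_geodesic G u c v"
    using length_apath_eq p pqr by (metis length_append)
qed

text \<open>The detour from \<open>a\<close> via \<open>x\<close> to \<open>b\<close> contains the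
  path from \<open>a\<close> to \<open>b\<close>, so \<open>c\<close> lies on one of its two legs.
  Contrapositively, not being separated by \<open>c\<close> is transitive.\<close>

lemma on_geodesic_split:
  assumes V: "a \<in> pverts G" "b \<in> pverts G" "c \<in> pverts G" "x \<in> pverts G"
    and c: "on_geodesic G a c b"
  shows "on_geodesic G a c x \<or> on_geodesic G x c b"
proof -
  obtain p where p: "apath a p x"
    using shortest_apath V by metis
  obtain q where q: "apath x q b"
    using shortest_apath V by metis
  have wp: "awalk a p x" and wq: "awalk x q b"
    using p q by (auto simp: apath_def)
  obtain r where "apath a r b" "set (awalk_verts a r) \<subseteq> set (awalk_verts a (p @ q))"
    using awalk_imp_apath_within[OF awalk_appendI[OF wp wq]] by blast
  then have "c \<in> set (awalk_verts a p) \<union> set (awalk_verts x q)"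
    using on_geodesic_iff_on_apath c V set_awalk_verts_append[OF wp wq] by blast
  then show ?thesis
    using on_geodesic_iff_on_apath p q V by blast
qed

text \<open>Equality of the two distances is excluded because the path from \<open>x\<close> to
  \<open>c\<close> either passes through \<open>c'\<close> or extends by the arc to the path to
  \<open>c'\<close>.\<close>

lemma graph_dist_arc_cases:
  assumes "(c, c') \<in> parcs G" "x \<in> pverts G"
  shows "graph_dist G x c' = graph_dist G x c + 1 \<or> graph_dist G x c = graph_dist G x c' + 1"
proof -
  have V: "c \<in> pverts G" "c' \<in> pverts G"
    using assms wellformed' by auto
  obtain p where p: "apath x p c"
    using shortest_apath assms V by metis
  show ?thesis
  proof (cases "c' \<in> set (awalk_verts x p)")
    case True
    then have "on_geodesic G x c' c"
      using on_geodesic_iff_on_apath p V by blast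
    then show ?thesis
      using graph_dist_arc assms arcs_symmetric by metis
  next
    case False
    have wp: "awalk x p c" "awlast x p = c"
      using p by (auto simp: apath_def)
    have "apath c [(c, c')] c'"
      using assms no_loops' by (auto simp: apath_simps intro: wellformed')
    then have "apath x (p @ [(c, c')]) c'"
      using False wp p by (simp add: apath_append_iff)
    then show ?thesis
      using length_apath_eq p by (metis One_nat_def length_append list.size(3,4) add_Suc_right add_0_right)
  qed
qed

text \<open>Induction along the path from \<open>a\<close> to \<open>b\<close>, with
  \<open>a'\<close> the vertex after \<open>a\<close>. If \<open>a'\<close> is nearer to
  \<open>d\<close> than \<open>a\<close>, the median for \<open>a'\<close> still works; otherwise
  \<open>a\<close> itself is the median.\<close>

lemma median_exists:
  assumes V: "a \<in> pverts G" "b \<in> pverts G" "d \<in> pverts G"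
  obtains c where "c \<in> pverts G" "on_geodesic G a c b" "on_geodesic G a c d" "on_geodesic G d c b"
proof -
  obtain p where p: "apath a p b"
    using shortest_apath V by metis
  have "\<exists>c\<in>pverts G. on_geodesic G a c b \<and> on_geodesic G a c d \<and> on_geodesic G d c b"
    using p V
  proof (induction p arbitrary: a)
    case Nil
    then show ?case
      by (intro bexI[of _ b]) (auto simp: apath_Nil_iff graph_dist_self graph_dist_commute)
  next
    case (Cons e p)
    obtain a' where e: "e = (a, a')"
      using Cons.prems by (cases e) (auto simp: apath_Cons_iff)
    have a': "(a, a') \<in> parcs G" "apath a' p b" "a' \<in> pverts G"
      using Cons.prems e wellformed' by (auto simp: apath_Cons_iff)
    have ab: "on_geodesic G a a' b"
      using on_geodesic_iff_on_apath[OF Cons.prems(1) a'(3)] hd_in_awalk_verts(2)[OF a'(2)] e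
      by simp
    obtain c where c: "c \<in> pverts G" "on_geodesic G a' c b" "on_geodesic G a' c d" "on_geodesic G d c b"
      using Cons.IH a' Cons.prems by blast
    have aa': "graph_dist G a a' = 1"
      using a' graph_dist_arc by blast
    \<comment> \<open>Since \<open>a'\<close> lies between \<open>a\<close> and \<open>b\<close>,
      and \<open>c\<close> between \<open>a'\<close> and \<open>b\<close>, the stretch from
      \<open>a\<close> via \<open>a'\<close> to \<open>c\<close> is also shortest.\<close>
    have ac: "graph_dist G a c = 1 + graph_dist G a' c"
      using c ab aa' graph_dist_triangle[of a c b] graph_dist_triangle[of a a' c] a' Cons.prems by linarith
    have sym: "graph_dist G u v = graph_dist G v u" if "u \<in> pverts G" "v \<in> pverts G" for u v
      using graph_dist_commute that .
    consider "graph_dist G d a = graph_dist G d a' + 1" | "graph_dist G d a' = graph_dist G d a + 1"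
      using graph_dist_arc_cases a' Cons.prems by (metis arcs_symmetric)
    then show ?case
    proof cases
      case 1
      then have "on_geodesic G a c d"
        using ac c sym a' Cons.prems by simp
      moreover have "on_geodesic G a c b"
        using ac c ab aa' by simp
      ultimately show ?thesis
        using c by blast
    next
      case 2
      have "on_geodesic G a a d" "on_geodesic G a a b"
        using graph_dist_self Cons.prems by simp_all
      moreover have "on_geodesic G d a b"
      proof -
        \<comment> \<open>The first alternative would make \<open>a'\<close> nearer to
          \<open>d\<close> than \<open>a\<close>, against the case assumption.\<close>
        have "on_geodesic G a a' d \<or> on_geodesic G d a' b"
          using on_geodesic_split[of a b a' d] ab a' Cons.prems by blast
        then have "on_geodesic G d a' b"
          using 2 sym aa' a' Cons.prems by auto
        then show ?thesis
          using 2 ab aa' by simp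
      qed
      ultimately show ?thesis
        using Cons.prems by blast
    qed
  qed
  then show ?thesis
    using that by blast
qed

end

lemma undirected_tree_graphI: "undirected_tree G \<Longrightarrow> undirected_tree_graph G"
  by (auto simp: undirected_tree_def undirected_tree_graph_def undirected_tree_graph_axioms_def
      connected_pair_graph_def connected_pair_graph_axioms_def)

section \<open>Distances in the Cartesian product\<close>

lemma pverts_cart_prod [simp]: "pverts (G \<box> H) = pverts G \<times> pverts H"
  by (simp add: cart_prod_def)

lemma parcs_cart_prod_iff:
  "((g, h), (g', h')) \<in> parcs (G \<box> H) \<longleftrightarrow>
     g = g' \<and> g \<in> pverts G \<and> (h, h') \<in> parcs H \<or>
     h = h' \<and> h \<in> pverts H \<and> (g, g') \<in> parcs G"
  by (simp add: cart_prod_def)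

context
  fixes G :: "'a pair_pre_digraph" and H :: "'b pair_pre_digraph"
  assumes G: "connected_pair_graph G" and H: "connected_pair_graph H"
begin

interpretation G: connected_pair_graph G by (fact G)
interpretation H: connected_pair_graph H by (fact H)
interpretation GH: pair_graph "G \<box> H"
  by (rule pair_graph_cart_prod) (fact G.pair_graph H.pair_graph)+

lemma awalk_cart_prod_fst:
  assumes "G.awalk g p g'" "h \<in> pverts H"
  shows "GH.awalk (g, h) (map (\<lambda>(x, y). ((x, h), (y, h))) p) (g', h)"
  using assms
  by (induction p arbitrary: g)
    (auto simp: G.awalk_simps GH.awalk_simps parcs_cart_prod_iff)

lemma awalk_cart_prod_snd:
  assumes "H.awalk h p h'" "g \<in> pverts G"
  shows "GH.awalk (g, h) (map (\<lambda>(x, y). ((g, x), (g, y))) p) (g, h')"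
  using assms
  by (induction p arbitrary: h)
    (auto simp: H.awalk_simps GH.awalk_simps parcs_cart_prod_iff)

text \<open>An arc of the product is an arc in one coordinate and constant in the other, so by the
  triangle inequality each step lowers the sum of the distances to \<open>v\<close> by at most
  one.\<close>

lemma dist_le_length_cart_prod_awalk:
  assumes "GH.awalk u p v"
  shows "graph_dist G (fst u) (fst v) + graph_dist H (snd u) (snd v) \<le> length p"
  using assms
proof (induction p arbitrary: u)
  case Nil
  then show ?case
    by (auto simp: GH.awalk_simps G.graph_dist_self H.graph_dist_self)
next
  case (Cons e p)
  obtain g h g' h' where e: "e = ((g, h), (g', h'))"
    by (metis prod.collapse)
  have u: "u = (g, h)" and arc: "((g, h), (g', h')) \<in> parcs (G \<box> H)"
    and w: "GH.awalk (g', h') p v"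
    using Cons.prems e by (auto simp: GH.awalk_simps)
  have IH: "graph_dist G g' (fst v) + graph_dist H h' (snd v) \<le> length p"
    using Cons.IH[OF w] by simp
  have V: "(g, h) \<in> pverts (G \<box> H)" "(g', h') \<in> pverts (G \<box> H)" "v \<in> pverts (G \<box> H)"
    using arc GH.wellformed' GH.awalk_last_in_verts[OF w] by blast+
  then have V: "g \<in> pverts G" "g' \<in> pverts G" "fst v \<in> pverts G"
    "h \<in> pverts H" "h' \<in> pverts H" "snd v \<in> pverts H"
    by auto
  have "graph_dist G g g' + graph_dist H h h' = 1"
    using arc unfolding parcs_cart_prod_iff
    using G.graph_dist_arc H.graph_dist_arc G.graph_dist_self H.graph_dist_self by auto
  moreover have "graph_dist G g (fst v) \<le> graph_dist G g g' + graph_dist G g' (fst v)"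
    using G.graph_dist_triangle V by blast
  moreover have "graph_dist H h (snd v) \<le> graph_dist H h h' + graph_dist H h' (snd v)"
    using H.graph_dist_triangle V by blast
  ultimately show ?case
    using IH u by simp
qed

lemma graph_dist_cart_prod:
  assumes "u \<in> pverts (G \<box> H)" "v \<in> pverts (G \<box> H)"
  shows "graph_dist (G \<box> H) u v =
    graph_dist G (fst u) (fst v) + graph_dist H (snd u) (snd v)"
proof -
  obtain g h g' h' where uv: "u = (g, h)" "v = (g', h')"
    by (metis prod.collapse)
  then have V: "g \<in> pverts G" "g' \<in> pverts G" "h \<in> pverts H" "h' \<in> pverts H"
    using assms by auto
  obtain p where p: "G.apath g p g'" "length p = graph_dist G g g'"
    using G.shortest_apath V by metis
  obtain q where q: "H.apath h q h'" "length q = graph_dist H h h'"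
    using H.shortest_apath V by metis
  \<comment> \<open>The upper bound comes from moving first in \<open>G\<close> at fixed
    \<open>h\<close>, then in \<open>H\<close> at fixed \<open>g'\<close>.\<close>
  obtain r where r: "GH.awalk u r v" "length r = length p + length q"
  proof
    show "GH.awalk u (map (\<lambda>(x, y). ((x, h), (y, h))) p @ map (\<lambda>(x, y). ((g', x), (g', y))) q) v"
      using awalk_cart_prod_fst awalk_cart_prod_snd p q V uv GH.awalk_appendI
      unfolding G.apath_def H.apath_def by blast
  qed simp
  obtain s where s: "GH.apath u s v" "length s = graph_dist (G \<box> H) u v"
    using GH.awalk_imp_shortest_apath r by blast
  have "graph_dist G g g' + graph_dist H h h' \<le> graph_dist (G \<box> H) u v"
    using dist_le_length_cart_prod_awalk s uv unfolding GH.apath_def by fastforce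
  moreover have "graph_dist (G \<box> H) u v \<le> length r"
    using r GH.graph_dist_le_length by blast
  ultimately show ?thesis
    using r p q uv by simp
qed

text \<open>The triangle inequality holds in each coordinate, so the sums agree only if both
  inequalities are equalities.\<close>

lemma on_geodesic_cart_prod:
  assumes "x \<in> pverts (G \<box> H)" "y \<in> pverts (G \<box> H)" "z \<in> pverts (G \<box> H)"
  shows "on_geodesic (G \<box> H) x z y \<longleftrightarrow>
    on_geodesic G (fst x) (fst z) (fst y) \<and> on_geodesic H (snd x) (snd z) (snd y)"
proof -
  have "graph_dist G (fst x) (fst y) \<le> graph_dist G (fst x) (fst z) + graph_dist G (fst z) (fst y)"
    "graph_dist H (snd x) (snd y) \<le> graph_dist H (snd x) (snd z) + graph_dist H (snd z) (snd y)"
    using assms by (auto intro: G.graph_dist_triangle H.graph_dist_triangle)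
  then show ?thesis
    using assms by (simp only: graph_dist_cart_prod) linarith
qed

end

section \<open>A largest general position set and a centre for the cross\<close>

context undirected_tree_graph
begin

text \<open>In the cross, \<open>c\<close> serves as the constant first or second coordinate of the
  arm taken from the other factor.\<close>

lemma gp_set_with_interior_vertex:
  assumes "3 \<le> card (pverts G)"
  obtains A c where "gen_pos_set G A" "card A = gp G" "c \<in> pverts G" "c \<notin> A"
    "\<And>x y. x \<in> A \<Longrightarrow> y \<in> A \<Longrightarrow> x \<noteq> y \<Longrightarrow> \<not> on_geodesic G x y c"
proof -
  obtain A where A: "gen_pos_set G A" "card A = gp G"
    using gp_attained .
  have AV: "A \<subseteq> pverts G"
    using A by (simp add: gen_pos_set_def)
  have gA: "\<not> on_geodesic G x z y"
    if "x \<in> A" "y \<in> A" "z \<in> A" "x \<noteq> y" "x \<noteq> z" "y \<noteq> z" for x y z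
    using A that unfolding gen_pos_set_def by blast
  show ?thesis
  proof (cases "3 \<le> card A")
    case True
    then obtain a b d where abd: "a \<in> A" "b \<in> A" "d \<in> A" "a \<noteq> b" "a \<noteq> d" "b \<noteq> d"
      unfolding numeral_3_eq_3 card_le_Suc_iff by auto
    then have V: "a \<in> pverts G" "b \<in> pverts G" "d \<in> pverts G"
      using AV by auto
    obtain c where c: "c \<in> pverts G" "on_geodesic G a c b" "on_geodesic G a c d" "on_geodesic G d c b"
      using median_exists V by blast
    show ?thesis
    proof (rule that[OF A c(1)])
      \<comment> \<open>At most one of \<open>a\<close>, \<open>b\<close>, \<open>d\<close> equals
        \<open>c\<close>, and \<open>c\<close> would lie strictly between the other two.\<close>
      show "c \<notin> A"
        using gA[of a b c] gA[of a d c] gA[of d b c] abd c by metis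
    next
      fix x y
      assume xy: "x \<in> A" "y \<in> A" "x \<noteq> y"
      then have xyV: "x \<in> pverts G" "y \<in> pverts G"
        using AV by auto
      show "\<not> on_geodesic G x y c"
      proof
        assume y: "on_geodesic G x y c"
        \<comment> \<open>If \<open>c\<close> lies between \<open>x\<close> and \<open>e\<close>, so
          does \<open>y\<close>, which general position allows only for
          \<open>y = e\<close>.\<close>
        have no: "y = e" if "e \<in> A" "on_geodesic G x c e" for e
        proof (rule ccontr)
          assume "y \<noteq> e"
          have eV: "e \<in> pverts G"
            using that AV by auto
          have ye: "on_geodesic G x y e"
            using y that(2) graph_dist_triangle[of y c e] graph_dist_triangle[of x y e] xyV eV c(1)
            by linarith
          show False
          proof (cases "x = e")
            case True
            then have "graph_dist G x y = 0"
              using ye graph_dist_self[of x] xyV by simp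
            then show False
              using graph_dist_eq_0D xyV xy by blast
          next
            case False
            then show False
              using gA[of x e y] ye that(1) xy \<open>y \<noteq> e\<close> by blast
          qed
        qed
        have sym: "on_geodesic G e c x \<Longrightarrow> on_geodesic G x c e" if "e \<in> pverts G" for e
          using graph_dist_commute c(1) xyV that by simp
        \<comment> \<open>\<open>c\<close> separates \<open>x\<close> from at least two of
          \<open>a\<close>, \<open>b\<close>, \<open>d\<close>; by \<open>no\<close> both would
          equal \<open>y\<close>.\<close>
        have "on_geodesic G x c a \<or> on_geodesic G x c b"
          "on_geodesic G x c a \<or> on_geodesic G x c d"
          "on_geodesic G x c d \<or> on_geodesic G x c b"
          using on_geodesic_split c xyV V sym by blast+
        then show False
          using no abd by metis
      qed
    qed
  next
    case False
    obtain a b d where abd: "a \<in> pverts G" "b \<in> pverts G" "d \<in> pverts G"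
      "a \<noteq> b" "a \<noteq> d" "b \<noteq> d"
      using assms unfolding numeral_3_eq_3 card_le_Suc_iff by auto
    note witness = that
    \<comment> \<open>Here \<open>gp G\<close> is at most 2, so every pair of distinct vertices is a
      largest general position set.\<close>
    have two: thesis
      if c: "c \<in> pverts G" "x \<in> pverts G" "y \<in> pverts G" "x \<noteq> y" "c \<noteq> x" "c \<noteq> y"
        "\<not> on_geodesic G x y c" "\<not> on_geodesic G y x c" for c x y
    proof (rule witness[OF _ _ c(1)])
      show gp: "gen_pos_set G {x, y}"
        using c by (auto simp: gen_pos_set_def)
      show "card {x, y} = gp G"
        using card_le_gp[OF gp] A False c by simp
    qed (use c in auto)
    have pos: "0 < graph_dist G u v" if "u \<in> pverts G" "v \<in> pverts G" "u \<noteq> v" for u v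
      using graph_dist_eq_0D that by blast
    have sym: "graph_dist G b a = graph_dist G a b" "graph_dist G d a = graph_dist G a d"
      "graph_dist G d b = graph_dist G b d"
      using graph_dist_commute abd by blast+
    have "0 < graph_dist G a b" "0 < graph_dist G b d" "0 < graph_dist G a d"
      using pos abd by blast+
    \<comment> \<open>Distances being positive, at most one of the three vertices lies between the
      other two. Two that do not form the pair, and the remaining one becomes
      \<open>c\<close>.\<close>
    then consider "\<not> on_geodesic G a b d" "\<not> on_geodesic G b a d"
      | "\<not> on_geodesic G a d b" "\<not> on_geodesic G d a b"
      | "\<not> on_geodesic G b d a" "\<not> on_geodesic G d b a"
      using sym by linarith
    then show thesis
      using two[of d a b] two[of b a d] two[of a b d] abd by cases blast+
  qed
qed

end

section \<open>Upper and lower bounds for the product of two trees\<close>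

context
  fixes T :: "'a pair_pre_digraph" and T' :: "'b pair_pre_digraph"
  assumes T: "undirected_tree_graph T" and T': "undirected_tree_graph T'"
begin

interpretation T: undirected_tree_graph T by (fact T)
interpretation T': undirected_tree_graph T' by (fact T')
interpretation TT': pair_graph "T \<box> T'"
  by (rule pair_graph_cart_prod) (fact T.pair_graph T'.pair_graph)+

lemmas on_geodesic_TT' =
  on_geodesic_cart_prod[OF T.connected_pair_graph_axioms T'.connected_pair_graph_axioms]

text \<open>As \<open>z\<close> separates \<open>x\<close> from \<open>y\<close> in
  \<open>T\<close>, it does not do so in \<open>T'\<close>. Then in \<open>T'\<close> it separates
  no point from \<open>x\<close> (fact \<open>wx\<close>), and transitivity through \<open>x\<close>
  covers every pair.\<close>

lemma gen_pos_set_coordinate_extreme: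
  assumes S: "gen_pos_set (T \<box> T') S" and z: "z \<in> S"
    and xy: "x \<in> S" "y \<in> S" "x \<noteq> y" "x \<noteq> z" "y \<noteq> z" "on_geodesic T (fst x) (fst z) (fst y)"
    and uv: "u \<in> S" "v \<in> S" "u \<noteq> v" "u \<noteq> z" "v \<noteq> z"
  shows "\<not> on_geodesic T' (snd u) (snd z) (snd v)"
proof -
  have V: "w \<in> pverts (T \<box> T')" if "w \<in> S" for w
    using S that unfolding gen_pos_set_def by blast
  then have V1: "fst w \<in> pverts T" "snd w \<in> pverts T'" if "w \<in> S" for w
    using that by fastforce+
  have gS: "\<not> on_geodesic T' (snd a) (snd z) (snd b)"
    if "a \<in> S" "b \<in> S" "a \<noteq> b" "a \<noteq> z" "b \<noteq> z" "on_geodesic T (fst a) (fst z) (fst b)" for a b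
  proof -
    have "\<not> on_geodesic (T \<box> T') a z b"
      using S z that unfolding gen_pos_set_def by blast
    then show ?thesis
      using on_geodesic_TT'[of a b z] V that z by blast
  qed
  have xy': "\<not> on_geodesic T' (snd x) (snd z) (snd y)"
    using gS xy by blast
  have split: "on_geodesic T' (snd a) (snd z) (snd c) \<or> on_geodesic T' (snd c) (snd z) (snd b)"
    if "on_geodesic T' (snd a) (snd z) (snd b)" "a \<in> S" "b \<in> S" "c \<in> S" for a b c
    using T'.on_geodesic_split V1 z that by blast
  have sym: "on_geodesic T' (snd b) (snd z) (snd a)"
    if "on_geodesic T' (snd a) (snd z) (snd b)" "a \<in> S" "b \<in> S" for a b
    using T'.graph_dist_commute V1 z that by simp
  \<comment> \<open>Otherwise \<open>z\<close> separates \<open>w\<close> from both \<open>x\<close>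
    and \<open>y\<close> in \<open>T'\<close>. In \<open>T\<close> it separates \<open>w\<close>
    from at least one of them, so this pair violates \<open>gS\<close>. The case
    \<open>w = x\<close> is included and says that \<open>snd x\<close> differs from
    \<open>snd z\<close>.\<close>
  have wx: "\<not> on_geodesic T' (snd x) (snd z) (snd w)" if w: "w \<in> S" "w \<noteq> z" for w
  proof
    assume *: "on_geodesic T' (snd x) (snd z) (snd w)"
    then have **: "on_geodesic T' (snd y) (snd z) (snd w)"
      using split[of x w y] xy xy' w by blast
    have "w \<noteq> x"
    proof
      assume "w = x"
      then have "on_geodesic T' (snd x) (snd z) (snd y)"
        using sym[OF **] xy by blast
      then show False
        using xy' by blast
    qed
    moreover have "w \<noteq> y"
      using * xy' by blast
    moreover have "on_geodesic T (fst x) (fst z) (fst w) \<or> on_geodesic T (fst w) (fst z) (fst y)"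
      using T.on_geodesic_split V1 z xy w by blast
    ultimately show False
      using gS[of x w] gS[of w y] * sym[OF **] xy w by blast
  qed
  show ?thesis
    using split[of u v x] sym[of u x] wx uv xy by blast
qed

lemma gen_pos_set_cart_prod_card_le:
  assumes S: "gen_pos_set (T \<box> T') S"
  shows "card S \<le> gp T + gp T'"
proof (cases "3 \<le> card S")
  case True
  have V: "fst w \<in> pverts T" "snd w \<in> pverts T'" if "w \<in> S" for w
    using S that unfolding gen_pos_set_def by fastforce+
  define A where "A = {z \<in> S. \<forall>x\<in>S. \<forall>y\<in>S. x \<noteq> y \<longrightarrow> x \<noteq> z \<longrightarrow> y \<noteq> z \<longrightarrow>
    \<not> on_geodesic T (fst x) (fst z) (fst y)}"
  define B where "B = {z \<in> S. \<forall>x\<in>S. \<forall>y\<in>S. x \<noteq> y \<longrightarrow> x \<noteq> z \<longrightarrow> y \<noteq> z \<longrightarrow>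
    \<not> on_geodesic T' (snd x) (snd z) (snd y)}"
  \<comment> \<open>A point outside \<open>A\<close> has a pair \<open>x\<close>, \<open>y\<close>
    around it in \<open>T\<close>, so it is extreme in \<open>T'\<close>.\<close>
  have "S = A \<union> B"
    using gen_pos_set_coordinate_extreme[OF S] unfolding A_def B_def by blast
  then have "card S \<le> card A + card B"
    using card_Un_le by blast
  moreover have "card A \<le> gp T"
    using V True by (intro T.card_le_gp_of_projection[where S = S and f = fst]) (auto simp: A_def)
  moreover have "card B \<le> gp T'"
    using V True by (intro T'.card_le_gp_of_projection[where S = S and f = snd]) (auto simp: B_def)
  ultimately show ?thesis
    by linarith
next
  case False
  \<comment> \<open>For at most two points, a singleton in each factor already gives the
    bound.\<close>
  obtain t t' where "t \<in> pverts T" "t' \<in> pverts T'"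
    using T.verts_nonempty T'.verts_nonempty by blast
  then have "gen_pos_set T {t}" "gen_pos_set T' {t'}"
    by (auto simp: gen_pos_set_def)
  then have "1 \<le> gp T" "1 \<le> gp T'"
    using T.card_le_gp[of "{t}"] T'.card_le_gp[of "{t'}"] by auto
  then show ?thesis
    using False by linarith
qed

text \<open>A middle point \<open>z\<close> is excluded by the coordinate varying along its arm. For
  \<open>z\<close> in \<open>A \<times> {c'}\<close>, two points of the other arm agree in the
  coordinate \<open>c\<close>, a mixed pair is excluded by the condition on \<open>c\<close>, and a
  pair in the same arm by general position of \<open>A\<close>.\<close>

lemma gen_pos_set_cross:
  assumes A: "gen_pos_set T A" "c \<in> pverts T" "c \<notin> A"
      "\<And>x y. x \<in> A \<Longrightarrow> y \<in> A \<Longrightarrow> x \<noteq> y \<Longrightarrow> \<not> on_geodesic T x y c"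
    and B: "gen_pos_set T' B" "c' \<in> pverts T'" "c' \<notin> B"
      "\<And>x y. x \<in> B \<Longrightarrow> y \<in> B \<Longrightarrow> x \<noteq> y \<Longrightarrow> \<not> on_geodesic T' x y c'"
  shows "gen_pos_set (T \<box> T') (A \<times> {c'} \<union> {c} \<times> B)"
proof -
  let ?S = "A \<times> {c'} \<union> {c} \<times> B"
  have AV: "A \<subseteq> pverts T" and BV: "B \<subseteq> pverts T'"
    using A B by (auto simp: gen_pos_set_def)
  then have V: "?S \<subseteq> pverts (T \<box> T')"
    using A B by auto
  have gA: "\<not> on_geodesic T x z y" if "x \<in> A" "y \<in> A" "z \<in> A" "x \<noteq> y" "x \<noteq> z" "y \<noteq> z" for x y z
    using A that unfolding gen_pos_set_def by blast
  have gB: "\<not> on_geodesic T' x z y" if "x \<in> B" "y \<in> B" "z \<in> B" "x \<noteq> y" "x \<noteq> z" "y \<noteq> z" for x y z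
    using B that unfolding gen_pos_set_def by blast
  have A': "\<not> on_geodesic T c y x" if "x \<in> A" "y \<in> A" "x \<noteq> y" for x y
    using A(4)[OF that] T.graph_dist_commute AV A(2) that by (metis add.commute subsetD)
  have B': "\<not> on_geodesic T' c' y x" if "x \<in> B" "y \<in> B" "x \<noteq> y" for x y
    using B(4)[OF that] T'.graph_dist_commute BV B(2) that by (metis add.commute subsetD)
  have self: "\<not> on_geodesic T x z x" if "x \<in> pverts T" "z \<in> pverts T" "x \<noteq> z" for x z
    using T.graph_dist_self T.graph_dist_eq_0D that by fastforce
  have self': "\<not> on_geodesic T' x z x" if "x \<in> pverts T'" "z \<in> pverts T'" "x \<noteq> z" for x z
    using T'.graph_dist_self T'.graph_dist_eq_0D that by fastforce
  have "\<not> on_geodesic (T \<box> T') x z y"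
    if xyz: "x \<in> ?S" "y \<in> ?S" "z \<in> ?S" "x \<noteq> y" "x \<noteq> z" "y \<noteq> z" for x y z
  proof
    assume "on_geodesic (T \<box> T') x z y"
    then have g: "on_geodesic T (fst x) (fst z) (fst y)" and g': "on_geodesic T' (snd x) (snd z) (snd y)"
      using on_geodesic_TT'[of x y z] V xyz by blast+
    consider (A) "fst z \<in> A" "snd z = c'" | (B) "fst z = c" "snd z \<in> B"
      using xyz by auto
    then show False
    proof cases
      case A
      then have z: "fst z \<in> pverts T" "c \<noteq> fst z"
        using AV assms(3) by auto
      have "fst x \<in> A \<and> snd x = c' \<or> fst x = c" "fst y \<in> A \<and> snd y = c' \<or> fst y = c"
        using xyz by auto
      moreover have "\<not> (fst x = c \<and> fst y = c)"
        using g self[OF assms(2) z] by metis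
      moreover have "\<not> (fst x \<in> A \<and> snd x = c' \<and> fst y = c)"
        using g A assms(4) xyz by (metis prod_eqI)
      moreover have "\<not> (fst y \<in> A \<and> snd y = c' \<and> fst x = c)"
        using g A A' xyz by (metis prod_eqI)
      moreover have "\<not> (fst x \<in> A \<and> snd x = c' \<and> fst y \<in> A \<and> snd y = c')"
        using g A gA xyz by (metis prod_eqI)
      ultimately show False
        by blast
    next
      case B
      then have z: "snd z \<in> pverts T'" "c' \<noteq> snd z"
        using BV assms(7) by auto
      have "fst x = c \<and> snd x \<in> B \<or> snd x = c'" "fst y = c \<and> snd y \<in> B \<or> snd y = c'"
        using xyz by auto
      moreover have "\<not> (snd x = c' \<and> snd y = c')"
        using g' self'[OF assms(6) z] by metis
      moreover have "\<not> (fst x = c \<and> snd x \<in> B \<and> snd y = c')"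
        using g' B assms(8) xyz by (metis prod_eqI)
      moreover have "\<not> (fst y = c \<and> snd y \<in> B \<and> snd x = c')"
        using g' B B' xyz by (metis prod_eqI)
      moreover have "\<not> (fst x = c \<and> snd x \<in> B \<and> fst y = c \<and> snd y \<in> B)"
        using g' B gB xyz by (metis prod_eqI)
      ultimately show False
        by blast
    qed
  qed
  then show ?thesis
    using V unfolding gen_pos_set_def by blast
qed

lemma gp_cart_prod:
  assumes "3 \<le> card (pverts T)" "3 \<le> card (pverts T')"
  shows "gp (T \<box> T') = gp T + gp T'"
proof -
  obtain A c where A: "gen_pos_set T A" "card A = gp T" "c \<in> pverts T" "c \<notin> A"
    "\<And>x y. x \<in> A \<Longrightarrow> y \<in> A \<Longrightarrow> x \<noteq> y \<Longrightarrow> \<not> on_geodesic T x y c"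
    using T.gp_set_with_interior_vertex assms by blast
  obtain B c' where B: "gen_pos_set T' B" "card B = gp T'" "c' \<in> pverts T'" "c' \<notin> B"
    "\<And>x y. x \<in> B \<Longrightarrow> y \<in> B \<Longrightarrow> x \<noteq> y \<Longrightarrow> \<not> on_geodesic T' x y c'"
    using T'.gp_set_with_interior_vertex assms by blast
  have "gen_pos_set (T \<box> T') (A \<times> {c'} \<union> {c} \<times> B)"
    using A B by (intro gen_pos_set_cross) auto
  \<comment> \<open>The arms are disjoint because \<open>c \<notin> A\<close>.\<close>
  moreover have "card (A \<times> {c'} \<union> {c} \<times> B) = gp T + gp T'"
    using A B T.finite_gen_pos_set T'.finite_gen_pos_set
    by (subst card_Un_disjoint) (auto simp: card_cartesian_product)
  ultimately show ?thesis
    using TT'.gp_eqI gen_pos_set_cart_prod_card_le by blast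
qed

end

theorem theorem1:
  fixes T :: "'a pair_pre_digraph" and T' :: "'b pair_pre_digraph"
  assumes "undirected_tree T" and "undirected_tree T'"
    and "min (card (pverts T)) (card (pverts T')) \<ge> 3"
  shows "gp (T \<box> T') = gp T + gp T'"
  using assms by (intro gp_cart_prod undirected_tree_graphI) auto

end
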